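(* For every $j\in\mathbb{N}$ and every $x\in\mathbb{C}$, $$G_{j,q}^{(\alpha)}(x)=\sum_{n=0}^{j}\binom{j}{n}_{q}\,x^{j-n}\,G_{n,q}^{(\alpha)}.$$
   Context: Fix $q\in\mathbb{C}$ with $|q|<1$ and a positive integer $\alpha$. Put $[x]_q=\frac{1-q^x}{1-q}$, $[n]_q!=[n]_q[n-1]_q\cdots[1]_q$ (with $[0]_q!=1$), and $\binom{k}{n}_q=\frac{[k]_q[k-1]_q\cdots[k-n+1]_q}{[n]_q!}$. The $q$-exponential is $e_q(z)=\sum_{l=0}^\infty \frac{z^l}{[l]_q!}$. The $q$-Genocchi polynomials of order $\alpha$, $G_{n,q}^{(\alpha)}(x)$, are defined by the generating function (power series in $z$) $$\sum_{n=0}^{\infty}\frac{z^n}{[n]_q!}G_{n,q}^{(\alpha)}(x)=\left(\frac{[2]_q z}{e_q(z)+1}\right)^{\alpha}e_q(zx),$$ and the $q$-Genocchi numbers of order $\alpha$, $G_{n,q}^{(\alpha)}$, by $$\sum_{n=0}^{\infty}\frac{z^n}{[n]_q!}G_{n,q}^{(\alpha)}=\left(\frac{[2]_q z}{e_q(z)+1}\right)^{\alpha}.$$ *)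

theory Defs
  imports Complex_Main "HOL-Computational_Algebra.Formal_Power_Series"
begin

definition q_bracket :: "complex \<Rightarrow> nat \<Rightarrow> complex" where
  "q_bracket q n = (1 - q ^ n) / (1 - q)"

definition q_fact :: "complex \<Rightarrow> nat \<Rightarrow> complex" where
  "q_fact q n = (\<Prod>i = 1..n. q_bracket q i)"

(* For n > k the truncated subtraction does no harm: the factor i = k is [0] = 0. *)
definition q_binomial :: "complex \<Rightarrow> nat \<Rightarrow> nat \<Rightarrow> complex" where
  "q_binomial q k n = (\<Prod>i<n. q_bracket q (k - i)) / q_fact q n"

(* Generating functions are formal power series in z = fps_X. *)
definition q_exp_fps :: "complex \<Rightarrow> complex fps" where
  "q_exp_fps q = Abs_fps (\<lambda>l. 1 / q_fact q l)"

definition q_genocchi_number_gf :: "complex \<Rightarrow> nat \<Rightarrow> complex fps" where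
  "q_genocchi_number_gf q \<alpha> =
     (fps_const (q_bracket q 2) * fps_X / (q_exp_fps q + 1)) ^ \<alpha>"

definition q_genocchi_poly_gf :: "complex \<Rightarrow> nat \<Rightarrow> complex \<Rightarrow> complex fps" where
  "q_genocchi_poly_gf q \<alpha> x =
     (fps_const (q_bracket q 2) * fps_X / (q_exp_fps q + 1)) ^ \<alpha>
       * (q_exp_fps q oo (fps_const x * fps_X))"

(* The coefficient of z^n / [n]! in the respective generating function; the lemmas
   q_genocchi_number_gf_eq and q_genocchi_poly_gf_eq below recover the defining series. *)
definition q_genocchi_number :: "complex \<Rightarrow> nat \<Rightarrow> nat \<Rightarrow> complex" where
  "q_genocchi_number q \<alpha> n = q_fact q n * fps_nth (q_genocchi_number_gf q \<alpha>) n"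

definition q_genocchi_poly :: "complex \<Rightarrow> nat \<Rightarrow> nat \<Rightarrow> complex \<Rightarrow> complex" where
  "q_genocchi_poly q \<alpha> n x = q_fact q n * fps_nth (q_genocchi_poly_gf q \<alpha> x) n"

lemma q_bracket_nonzero:
  assumes "norm q < 1" and "n > 0"
  shows "q_bracket q n \<noteq> 0"
proof -
  have "norm (q ^ n) < 1"
    using assms by (simp add: norm_power power_less_one_iff)
  then have "q ^ n \<noteq> 1" by auto
  moreover have "q \<noteq> 1" using assms by auto
  ultimately show ?thesis by (simp add: q_bracket_def)
qed

lemma q_fact_nonzero:
  assumes "norm q < 1"
  shows "q_fact q n \<noteq> 0"
  using q_bracket_nonzero[OF assms] by (auto simp: q_fact_def)

lemma q_genocchi_number_gf_eq:
  assumes "norm q < 1"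
  shows "Abs_fps (\<lambda>n. q_genocchi_number q \<alpha> n / q_fact q n) =
    (fps_const (q_bracket q 2) * fps_X / (q_exp_fps q + 1)) ^ \<alpha>"
  using q_fact_nonzero[OF assms]
  by (simp add: fps_eq_iff q_genocchi_number_def q_genocchi_number_gf_def)

lemma q_genocchi_poly_gf_eq:
  assumes "norm q < 1"
  shows "Abs_fps (\<lambda>n. q_genocchi_poly q \<alpha> n x / q_fact q n) =
    (fps_const (q_bracket q 2) * fps_X / (q_exp_fps q + 1)) ^ \<alpha>
      * (q_exp_fps q oo (fps_const x * fps_X))"
  using q_fact_nonzero[OF assms]
  by (simp add: fps_eq_iff q_genocchi_poly_def q_genocchi_poly_gf_def)

(* The denominator is a unit, so the division above is a genuine quotient. *)
lemma q_exp_fps_plus_1_unit: "fps_nth (q_exp_fps q + 1) 0 \<noteq> 0"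
  by (simp add: q_exp_fps_def q_fact_def)

end

theory Submission
  imports Defs
begin

text \<open>
  Replacing \<open>z\<close> by \<open>x z\<close> in the \<open>q\<close>-exponential multiplies its \<open>l\<close>-th coefficient by
  \<open>x ^ l\<close>. The generating function of the \<open>q\<close>-Genocchi polynomials is therefore that of the
  \<open>q\<close>-Genocchi numbers times the series with coefficients \<open>x ^ l / [l]!\<close>, and the claim
  compares coefficients in this Cauchy product. The \<open>q\<close>-binomial coefficients appear because
  \<open>[j]! / ([n]! [j - n]!)\<close> equals the falling product that defines them
  (\<open>q_binomial_eq_q_fact_quotient\<close>); this cancellation is legitimate for \<open>norm q < 1\<close>,
  where no \<open>q\<close>-factorial vanishes.
\<close>

lemma q_fact_eq_falling_product:
  assumes "n \<le> k"
  shows "q_fact q k = (\<Prod>i<n. q_bracket q (k - i)) * q_fact q (k - n)"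
  using assms
proof (induction n)
  case 0
  then show ?case by simp
next
  case (Suc n)
  then have "k - n = Suc (k - Suc n)" by simp
  then have "q_fact q (k - n) = q_bracket q (k - n) * q_fact q (k - Suc n)"
    by (simp add: q_fact_def)
  with Suc show ?case by (simp add: mult.assoc)
qed

lemma q_binomial_eq_q_fact_quotient:
  assumes "norm q < 1" and "n \<le> k"
  shows "q_binomial q k n = q_fact q k / (q_fact q n * q_fact q (k - n))"
  using q_fact_nonzero[OF assms(1)] q_fact_eq_falling_product[OF assms(2), of q]
  by (simp add: q_binomial_def)

theorem theorem2p1:
  fixes q x :: complex and \<alpha> j :: nat
  assumes "norm q < 1" and "\<alpha> > 0"
  shows "q_genocchi_poly q \<alpha> j x =
    (\<Sum>n = 0..j. q_binomial q j n * x ^ (j - n) * q_genocchi_number q \<alpha> n)"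
proof -
  have "q_genocchi_poly q \<alpha> j x = (\<Sum>n = 0..j.
      q_fact q j * (fps_nth (q_genocchi_number_gf q \<alpha>) n * (x ^ (j - n) / q_fact q (j - n))))"
    by (simp add: q_genocchi_poly_def q_genocchi_poly_gf_def fps_mult_nth
        q_exp_fps_def fps_compose_linear sum_distrib_left flip: q_genocchi_number_gf_def[unfolded q_exp_fps_def])
  also have "\<dots> = (\<Sum>n = 0..j. q_binomial q j n * x ^ (j - n) * q_genocchi_number q \<alpha> n)"
    using q_fact_nonzero[OF assms(1)]
    by (intro sum.cong)
      (simp_all add: q_binomial_eq_q_fact_quotient[OF assms(1)] q_genocchi_number_def)
  finally show ?thesis .
qed

end
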